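(* Let $\phi$ be a decision-DNNF formula with $|\mathcal{V}(\phi)| = n$, and let $w$ be a weight assignment with all literal weights nonnegative, i.e. $w(x)\ge 0$ and $w(\overline{x})\ge 0$ for every variable $x$. Suppose the weighted model count of $\phi$ is computed using floating-point arithmetic with a $p$-bit fraction, where $\log_2 n \le p/2 - 1$. Then the computed value $\hat{w}(\phi)$ approximates the true weighted count $w(\phi)$ with decimal precision satisfying $$\Delta(\hat{w}(\phi), w(\phi)) \;\ge\; p\cdot \log_{10} 2 - \log_{10} n - c,$$ where $c = \log_{10} 7$ when rescaling is required (the computation with rescaling is used) and $c = \log_{10} 4$ when no rescaling is required (the computation without rescaling is used).
   Context: **Formulas.** Formulas over a finite set of Boolean variables $X$ are in negation normal form: they are built recursively from literals ($x$ or $\overline{x}$ with $x\in X$), binary conjunctions $\phi_1\land\phi_2$ and binary disjunctions $\phi_1\lor\phi_2$ (there are no constants). $\mathcal{V}(\phi)$ is the set of variables occurring in $\phi$. A formula is decision-DNNF if (i) every conjunction $\phi_1\land\phi_2$ occurring as a subformula is decomposable, i.e. $\mathcal{V}(\phi_1)\cap\mathcal{V}(\phi_2)=\emptyset$, and (ii) every disjunction occurring as a subformula has the form $(x\land\phi_1)\lor(\overline{x}\land\phi_2)$ for some variable $x$. (Such disjunctions are deterministic: the two disjuncts have no common model.) A formula is smooth if every disjunction $\phi_1\lor\phi_2$ in it has $\mathcal{V}(\phi_1)=\mathcal{V}(\phi_2)$. The variable set is taken to be $X=\mathcal{V}(\phi)$. **Weighted count.** A weight assignment $w$ gives rational values $w(x),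 w(\overline{x})$ for each $x\in X$. An assignment $\alpha:X\to\{0,1\}$ is identified with the set of literals it makes true; $\mathcal{M}(\phi)$ is the set of assignments satisfying $\phi$. The weighted count is $w(\phi)=\sum_{\alpha\in\mathcal{M}(\phi)}\prod_{\ell\in\alpha} w(\ell)$. **Errors.** For a rational $v$ and approximation $\hat v$, $\delta[\hat v,v]=|\hat v-v|/|v|$ if $v\neq 0$; $\delta[\hat v,v]=0$ if $v=\hat v=0$; $\delta[\hat v,v]=1$ if $v=0\neq\hat v$. The decimal precision is $\Delta(\hat v,v)=\max(0,-\log_{10}\delta[\hat v,v])$ (equal to $+\infty$ when $\hat v=v$). **Floating point.** With a $p$-bit fraction, floating-point numbers have the form $(-1)^s\cdot f\cdot 2^e$, where $s \in \{0,1\}$, $f$ is a $p$-bit binary fraction with $0\le f\le 1-2^{-p}$, and $e$ is an integer. Let $\varepsilon=2^{-p}$. It is assumed throughout that no underflow or overflow occurs, so rounding a rational number $v$ to a floating-point number $\mathit{Rnd}(v)$ satisfies $\delta[\mathit{Rnd}(v),v]\le\varepsilon$; each floating-point operation computes the exact result of the operation on its (floating-point) arguments and then applies $\mathit{Rnd}$. **Arithmetic evaluation.** Given rational literal values $W(\ell)$, the exact evaluation is defined by $W(\phi_1\land\phi_2)=W(\phi_1)\cdot W(\phi_2)$ and $W(\phi_1\lor\phi_2)=W(\phi_1)+W(\phi_2)$. The floating-point evaluation starts from floating-point literal values $\hat W(\ell)$ with $\delta[\hat W(\ell),W(\ell)]\le\varepsilon$ and computes $\hat W(\phi_1\land\phi_2)=\mathit{Rnd}(\hat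 W(\phi_1)\cdot\hat W(\phi_2))$ and $\hat W(\phi_1\lor\phi_2)=\mathit{Rnd}(\hat W(\phi_1)+\hat W(\phi_2))$. **Computing the weighted count.** *Without rescaling* (applicable when $w(x)+w(\overline{x})=1$ for every $x\in X$, or when $\phi$ is smooth): set $W(\ell)=w(\ell)$ for every literal; then $w(\phi)=W(\phi)$, and the computed value is $\hat w(\phi)=\hat W(\phi)$. *With rescaling* (applicable when $w(x)+w(\overline{x})\neq 0$ for every $x\in X$): set $s(x)=w(x)+w(\overline{x})$, $W(x)=w(x)/s(x)$, $W(\overline{x})=w(\overline{x})/s(x)$; then $w(\phi)=W(\phi)\cdot\prod_{x\in X}s(x)$. Each $s(x)$ is represented by a floating-point number $\hat s(x)$ with $\delta[\hat s(x),s(x)]\le\varepsilon$; the product $P=\prod_{x\in X}s(x)$ is approximated by $\hat P$, obtained by multiplying the $\hat s(x)$ by binary floating-point multiplications in an arbitrary association; and the computed value is $\hat w(\phi)=\mathit{Rnd}(\hat W(\phi)\cdot\hat P)$. *)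

theory Defs
  imports Complex_Main "HOL-Library.FuncSet" "HOL-Library.Extended_Real"
begin

datatype 'v literal = Pos 'v | Neg 'v

datatype 'v nnf =
    Lit "'v literal"
  | Conj "'v nnf" "'v nnf"
  | Disj "'v nnf" "'v nnf"

fun lit_var :: "'v literal \<Rightarrow> 'v" where
  "lit_var (Pos x) = x"
| "lit_var (Neg x) = x"

fun vars :: "'v nnf \<Rightarrow> 'v set" where
  "vars (Lit l) = {lit_var l}"
| "vars (Conj \<phi>1 \<phi>2) = vars \<phi>1 \<union> vars \<phi>2"
| "vars (Disj \<phi>1 \<phi>2) = vars \<phi>1 \<union> vars \<phi>2"

fun subformulas :: "'v nnf \<Rightarrow> 'v nnf set" where
  "subformulas (Lit l) = {Lit l}"
| "subformulas (Conj \<phi>1 \<phi>2) = {Conj \<phi>1 \<phi>2} \<union> subformulas \<phi>1 \<union> subformulas \<phi>2"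
| "subformulas (Disj \<phi>1 \<phi>2) = {Disj \<phi>1 \<phi>2} \<union> subformulas \<phi>1 \<union> subformulas \<phi>2"

definition decision_dnnf :: "'v nnf \<Rightarrow> bool" where
  "decision_dnnf \<phi> \<longleftrightarrow>
     (\<forall>\<psi>1 \<psi>2. Conj \<psi>1 \<psi>2 \<in> subformulas \<phi> \<longrightarrow> vars \<psi>1 \<inter> vars \<psi>2 = {}) \<and>
     (\<forall>\<psi>1 \<psi>2. Disj \<psi>1 \<psi>2 \<in> subformulas \<phi> \<longrightarrow>
        (\<exists>x \<chi>1 \<chi>2. \<psi>1 = Conj (Lit (Pos x)) \<chi>1 \<and> \<psi>2 = Conj (Lit (Neg x)) \<chi>2))"

definition smooth :: "'v nnf \<Rightarrow> bool" where
  "smooth \<phi> \<longleftrightarrow> (\<forall>\<psi>1 \<psi>2. Disj \<psi>1 \<psi>2 \<in> subformulas \<phi> \<longrightarrow> vars \<psi>1 = vars \<psi>2)"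


fun lit_true :: "('v \<Rightarrow> bool) \<Rightarrow> 'v literal \<Rightarrow> bool" where
  "lit_true \<alpha> (Pos x) \<longleftrightarrow> \<alpha> x"
| "lit_true \<alpha> (Neg x) \<longleftrightarrow> \<not> \<alpha> x"

fun satisfies :: "('v \<Rightarrow> bool) \<Rightarrow> 'v nnf \<Rightarrow> bool" where
  "satisfies \<alpha> (Lit l) \<longleftrightarrow> lit_true \<alpha> l"
| "satisfies \<alpha> (Conj \<phi>1 \<phi>2) \<longleftrightarrow> satisfies \<alpha> \<phi>1 \<and> satisfies \<alpha> \<phi>2"
| "satisfies \<alpha> (Disj \<phi>1 \<phi>2) \<longleftrightarrow> satisfies \<alpha> \<phi>1 \<or> satisfies \<alpha> \<phi>2"

text \<open>Models are total assignments of \<open>vars \<phi>\<close>; the extensional function space makes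
  each of them be counted exactly once.\<close>

definition models :: "'v nnf \<Rightarrow> ('v \<Rightarrow> bool) set" where
  "models \<phi> = {\<alpha> \<in> vars \<phi> \<rightarrow>\<^sub>E UNIV. satisfies \<alpha> \<phi>}"

definition true_literals :: "'v set \<Rightarrow> ('v \<Rightarrow> bool) \<Rightarrow> 'v literal set" where
  "true_literals X \<alpha> = {l. lit_var l \<in> X \<and> lit_true \<alpha> l}"

definition weighted_count :: "('v literal \<Rightarrow> rat) \<Rightarrow> 'v nnf \<Rightarrow> rat" where
  "weighted_count w \<phi> = (\<Sum>\<alpha>\<in>models \<phi>. \<Prod>l\<in>true_literals (vars \<phi>) \<alpha>. w l)"


text \<open>In both definitions below the first argument is the approximation and the second one
  the exact value.\<close>

definition rel_error :: "rat \<Rightarrow> rat \<Rightarrow> rat" where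
  "rel_error v' v =
     (if v \<noteq> 0 then \<bar>v' - v\<bar> / \<bar>v\<bar> else if v' = 0 then 0 else 1)"

definition decimal_precision :: "rat \<Rightarrow> rat \<Rightarrow> ereal" where
  "decimal_precision v' v =
     max 0 (if rel_error v' v = 0 then \<infinity>
            else ereal (- log 10 (real_of_rat (rel_error v' v))))"


text \<open>The \<open>p\<close>-bit fraction is \<open>k / 2 ^ p\<close>. The exponent is unbounded, which is how the
  absence of underflow and overflow is modelled.\<close>

definition fp_numbers :: "nat \<Rightarrow> rat set" where
  "fp_numbers p =
     {(-1) ^ s * (of_nat k / 2 ^ p) * (2 powi e) | (s::nat) (k::nat) (e::int).
        s \<in> {0, 1} \<and> k \<le> 2 ^ p - 1}"

definition fp_approx :: "nat \<Rightarrow> rat \<Rightarrow> rat \<Rightarrow> bool" where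
  "fp_approx p v' v \<longleftrightarrow> v' \<in> fp_numbers p \<and> rel_error v' v \<le> 1 / 2 ^ p"

text \<open>No particular rounding mode is fixed.\<close>

definition fp_rounding :: "nat \<Rightarrow> (rat \<Rightarrow> rat) \<Rightarrow> bool" where
  "fp_rounding p Rnd \<longleftrightarrow> (\<forall>v. fp_approx p (Rnd v) v)"

definition fp_literals :: "nat \<Rightarrow> 'v set \<Rightarrow> ('v literal \<Rightarrow> rat) \<Rightarrow> ('v literal \<Rightarrow> rat) \<Rightarrow> bool" where
  "fp_literals p X W' W \<longleftrightarrow> (\<forall>l. lit_var l \<in> X \<longrightarrow> fp_approx p (W' l) (W l))"

fun fp_eval :: "(rat \<Rightarrow> rat) \<Rightarrow> ('v literal \<Rightarrow> rat) \<Rightarrow> 'v nnf \<Rightarrow> rat" where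
  "fp_eval Rnd W' (Lit l) = W' l"
| "fp_eval Rnd W' (Conj \<phi>1 \<phi>2) = Rnd (fp_eval Rnd W' \<phi>1 * fp_eval Rnd W' \<phi>2)"
| "fp_eval Rnd W' (Disj \<phi>1 \<phi>2) = Rnd (fp_eval Rnd W' \<phi>1 + fp_eval Rnd W' \<phi>2)"

text \<open>\<open>fp_prod Rnd s' X P\<close>: some way of associating (and ordering) the product of the
  \<open>s' x\<close>, \<open>x \<in> X\<close>, into binary floating-point multiplications computes \<open>P\<close>.\<close>

inductive fp_prod :: "(rat \<Rightarrow> rat) \<Rightarrow> ('v \<Rightarrow> rat) \<Rightarrow> 'v set \<Rightarrow> rat \<Rightarrow> bool"
  for Rnd :: "rat \<Rightarrow> rat" and s' :: "'v \<Rightarrow> rat" where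
  single: "fp_prod Rnd s' {x} (s' x)"
| mult: "fp_prod Rnd s' X P \<Longrightarrow> fp_prod Rnd s' Y Q \<Longrightarrow> X \<inter> Y = {} \<Longrightarrow>
    fp_prod Rnd s' (X \<union> Y) (Rnd (P * Q))"


definition scale :: "('v literal \<Rightarrow> rat) \<Rightarrow> 'v \<Rightarrow> rat" where
  "scale w x = w (Pos x) + w (Neg x)"

definition rescaled :: "('v literal \<Rightarrow> rat) \<Rightarrow> 'v literal \<Rightarrow> rat" where
  "rescaled w l = w l / scale w (lit_var l)"

text \<open>The next two predicates say that \<open>v\<close> is a possible outcome of the computation without
  (respectively with) rescaling; each includes the condition under which that computation is
  applicable.\<close>

definition computed_without_rescaling ::
    "nat \<Rightarrow> (rat \<Rightarrow> rat) \<Rightarrow> ('v literal \<Rightarrow> rat) \<Rightarrow> 'v nnf \<Rightarrow> rat \<Rightarrow> bool" where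
  "computed_without_rescaling p Rnd w \<phi> v \<longleftrightarrow>
     ((\<forall>x\<in>vars \<phi>. w (Pos x) + w (Neg x) = 1) \<or> smooth \<phi>) \<and>
     (\<exists>W'. fp_literals p (vars \<phi>) W' w \<and> v = fp_eval Rnd W' \<phi>)"

definition computed_with_rescaling ::
    "nat \<Rightarrow> (rat \<Rightarrow> rat) \<Rightarrow> ('v literal \<Rightarrow> rat) \<Rightarrow> 'v nnf \<Rightarrow> rat \<Rightarrow> bool" where
  "computed_with_rescaling p Rnd w \<phi> v \<longleftrightarrow>
     (\<forall>x\<in>vars \<phi>. w (Pos x) + w (Neg x) \<noteq> 0) \<and>
     (\<exists>W' s' P.
        fp_literals p (vars \<phi>) W' (rescaled w) \<and>
        (\<forall>x\<in>vars \<phi>. fp_approx p (s' x) (scale w x)) \<and>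
        fp_prod Rnd s' (vars \<phi>) P \<and>
        v = Rnd (fp_eval Rnd W' \<phi> * P))"

end

theory Submission
  imports Defs
begin

text \<open>
  All quantities involved are nonnegative, so relative errors only accumulate multiplicatively:
  products and sums of nonnegative numbers never cancel.  With \<open>\<epsilon> = 2 ^ -p\<close>, call
  \<open>v'\<close> a \<open>k\<close>-fold approximation of \<open>v \<ge> 0\<close> if it lies between
  \<open>(1 - \<epsilon>) ^ k * v\<close> and \<open>(1 + \<epsilon>) ^ k * v\<close>.  The orders \<open>k\<close> add under
  multiplication, their maximum is taken under addition, and every rounding adds one.

  In a decision-DNNF formula with \<open>n\<close> variables the evaluation therefore has order at most
  \<open>3 * n - 2\<close> (lemma \<open>close_to_fp_eval\<close>): a literal has order \<open>1\<close>; a decomposable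
  conjunction of formulas with \<open>n1\<close> and \<open>n2\<close> variables has order at most
  \<open>(3 * n1 - 2) + (3 * n2 - 2) + 1\<close>; and a decision on \<open>x\<close> eliminates one variable, at the
  cost of three units (the literal, the conjunction, the disjunction).  The product of the \<open>n\<close>
  scale factors has order \<open>2 * n - 1\<close>, for \<open>n\<close> roundings of factors and \<open>n - 1\<close> of
  products (lemma \<open>close_to_fp_prod\<close>), so the rescaled computation has order
  \<open>(3 * n - 2) + (2 * n - 1) + 1 = 5 * n - 2\<close>.

  The hypothesis on \<open>p\<close> says \<open>4 * n\<^sup>2 * \<epsilon> \<le> 1\<close>, which makes the second order terms
  harmless: a
  \<open>k\<close>-fold approximation with \<open>k * \<epsilon> \<le> 1\<close> has relative error at most
  \<open>k * \<epsilon> + (k * \<epsilon>)\<^sup>2\<close>, and this is at most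
  \<open>4 * n * \<epsilon>\<close> for \<open>k = 3 * n - 2\<close> and at most \<open>7 * n * \<epsilon>\<close> for
  \<open>k = 5 * n - 2\<close>.

  That the exact evaluation yields the weighted count follows from factoring the sum over
  assignments along decomposable conjunctions and splitting it at decisions (lemma
  \<open>count_over_eq_exact_eval\<close>).  After rescaling, the two weights of each variable sum to one,
  and the scale factors can be pulled out of the weighted count.
\<close>

section \<open>Decision-DNNF formulas\<close>

lemma subformulas_refl [simp]: "\<phi> \<in> subformulas \<phi>"
  by (cases \<phi>) auto

lemma finite_vars [simp]: "finite (vars \<phi>)"
  by (induction \<phi>) auto

lemma vars_nonempty [simp]: "vars \<phi> \<noteq> {}"
  by (induction \<phi>) auto

lemma card_vars_ge_1: "card (vars \<phi>) \<ge> 1"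
  by (simp add: Suc_le_eq card_gt_0_iff)

lemma decision_dnnf_ConjD:
  assumes "decision_dnnf (Conj \<phi> \<psi>)"
  shows "decision_dnnf \<phi>" "decision_dnnf \<psi>" "vars \<phi> \<inter> vars \<psi> = {}"
  using assms subformulas_refl [of "Conj \<phi> \<psi>"]
  unfolding decision_dnnf_def subformulas.simps by blast+

lemma decision_dnnf_DisjE:
  assumes "decision_dnnf (Disj \<phi> \<psi>)"
  obtains x \<chi>1 \<chi>2 where "\<phi> = Conj (Lit (Pos x)) \<chi>1" "\<psi> = Conj (Lit (Neg x)) \<chi>2"
    "decision_dnnf \<chi>1" "decision_dnnf \<chi>2" "x \<notin> vars \<chi>1" "x \<notin> vars \<chi>2"
proof -
  obtain x \<chi>1 \<chi>2 where eq: "\<phi> = Conj (Lit (Pos x)) \<chi>1" "\<psi> = Conj (Lit (Neg x)) \<chi>2"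
    using assms unfolding decision_dnnf_def by (meson subformulas_refl)
  have "decision_dnnf \<phi>" "decision_dnnf \<psi>"
    using assms unfolding decision_dnnf_def subformulas.simps by blast+
  then have "decision_dnnf \<chi>1" "x \<notin> vars \<chi>1" "decision_dnnf \<chi>2" "x \<notin> vars \<chi>2"
    using decision_dnnf_ConjD [of "Lit (Pos x)" \<chi>1] decision_dnnf_ConjD [of "Lit (Neg x)" \<chi>2]
    by (simp_all add: eq)
  with eq show ?thesis
    by (intro that)
qed

text \<open>The induction principle of the class: a decision is treated as one connective, with the
  induction hypotheses for the formulas guarded by the two literals.\<close>

lemma decision_dnnf_induct [consumes 1, case_names Lit Conj Decide]:
  assumes "decision_dnnf \<phi>"
    and lit: "\<And>l. P (Lit l)"
    and conj: "\<And>\<phi> \<psi>. vars \<phi> \<inter> vars \<psi> = {} \<Longrightarrow> P \<phi> \<Longrightarrow> P \<psi> \<Longrightarrow> P (Conj \<phi> \<psi>)"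
    and decide: "\<And>x \<phi> \<psi>. x \<notin> vars \<phi> \<Longrightarrow> x \<notin> vars \<psi> \<Longrightarrow> P \<phi> \<Longrightarrow> P \<psi> \<Longrightarrow>
      P (Disj (Conj (Lit (Pos x)) \<phi>) (Conj (Lit (Neg x)) \<psi>))"
  shows "P \<phi>"
  using assms(1)
proof (induction \<phi> rule: measure_induct_rule [where f = size])
  case (less \<phi>)
  show ?case
  proof (cases \<phi>)
    case (Lit l)
    then show ?thesis by (simp add: lit)
  next
    case (Conj \<psi>1 \<psi>2)
    then show ?thesis
      using less decision_dnnf_ConjD [of \<psi>1 \<psi>2] by (auto intro!: conj)
  next
    case (Disj \<psi>1 \<psi>2)
    then obtain x \<chi>1 \<chi>2 where "\<psi>1 = Conj (Lit (Pos x)) \<chi>1" "\<psi>2 = Conj (Lit (Neg x)) \<chi>2"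
      "decision_dnnf \<chi>1" "decision_dnnf \<chi>2" "x \<notin> vars \<chi>1" "x \<notin> vars \<chi>2"
      using less.prems by (auto elim: decision_dnnf_DisjE)
    then show ?thesis
      using less.IH Disj by (auto intro!: decide)
  qed
qed

section \<open>Exact evaluation computes the weighted count\<close>

text \<open>The value of a formula under exact arithmetic.\<close>

fun exact_eval :: "('v literal \<Rightarrow> rat) \<Rightarrow> 'v nnf \<Rightarrow> rat" where
  "exact_eval W (Lit l) = W l"
| "exact_eval W (Conj \<phi> \<psi>) = exact_eval W \<phi> * exact_eval W \<psi>"
| "exact_eval W (Disj \<phi> \<psi>) = exact_eval W \<phi> + exact_eval W \<psi>"

text \<open>The literal of the variable \<open>x\<close> that the assignment \<open>\<alpha>\<close> makes true.\<close>

definition literal_of :: "('v \<Rightarrow> bool) \<Rightarrow> 'v \<Rightarrow> 'v literal" where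
  "literal_of \<alpha> x = (if \<alpha> x then Pos x else Neg x)"

text \<open>The weighted count relative to a set \<open>X\<close> of variables that may be larger than the set of
  variables of the formula.  The subformulas of a formula have fewer variables, so an inductive
  proof has to let \<open>X\<close> vary.\<close>

definition count_over :: "'v set \<Rightarrow> ('v literal \<Rightarrow> rat) \<Rightarrow> 'v nnf \<Rightarrow> rat" where
  "count_over X w \<phi> =
     (\<Sum>\<alpha>\<in>X \<rightarrow>\<^sub>E UNIV. of_bool (satisfies \<alpha> \<phi>) * (\<Prod>x\<in>X. w (literal_of \<alpha> x)))"

lemma true_literals_eq: "true_literals X \<alpha> = literal_of \<alpha> ` X"
proof -
  have "l \<in> true_literals X \<alpha> \<longleftrightarrow> l \<in> literal_of \<alpha> ` X" for l
    by (cases l) (auto simp: true_literals_def literal_of_def image_iff)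
  then show ?thesis by blast
qed

lemma prod_true_literals: "(\<Prod>l\<in>true_literals X \<alpha>. w l) = (\<Prod>x\<in>X. w (literal_of \<alpha> x))"
proof -
  have "inj_on (literal_of \<alpha>) X"
    by (auto simp: inj_on_def literal_of_def split: if_splits)
  then show ?thesis
    by (simp add: true_literals_eq prod.reindex)
qed

lemma weighted_count_eq_count_over: "weighted_count w \<phi> = count_over (vars \<phi>) w \<phi>"
proof -
  have "finite (vars \<phi> \<rightarrow>\<^sub>E (UNIV :: bool set))"
    by (intro finite_PiE) auto
  then show ?thesis
    unfolding weighted_count_def count_over_def models_def prod_true_literals
    by (intro sum.mono_neutral_cong_left) auto
qed

lemma satisfies_cong: "(\<And>x. x \<in> vars \<phi> \<Longrightarrow> \<alpha> x = \<beta> x) \<Longrightarrow> satisfies \<alpha> \<phi> = satisfies \<beta> \<phi>"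
proof (induction \<phi>)
  case (Lit l)
  then show ?case by (cases l) auto
qed auto

lemma satisfies_restrict: "vars \<phi> \<subseteq> A \<Longrightarrow> satisfies (restrict \<alpha> A) \<phi> = satisfies \<alpha> \<phi>"
  by (intro satisfies_cong) auto

lemma sum_PiE_Un:
  fixes f g :: "('a \<Rightarrow> 'b) \<Rightarrow> 'c :: comm_semiring_0"
  assumes "A \<inter> B = {}"
  shows "(\<Sum>\<alpha>\<in>A \<union> B \<rightarrow>\<^sub>E S. f (restrict \<alpha> A) * g (restrict \<alpha> B)) =
    (\<Sum>\<alpha>\<in>A \<rightarrow>\<^sub>E S. f \<alpha>) * (\<Sum>\<alpha>\<in>B \<rightarrow>\<^sub>E S. g \<alpha>)"
proof -
  have disj: "x \<notin> B" if "x \<in> A" for x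
    using assms that by blast
  have "(\<Sum>\<alpha>\<in>A \<union> B \<rightarrow>\<^sub>E S. f (restrict \<alpha> A) * g (restrict \<alpha> B)) =
    (\<Sum>(\<beta>, \<gamma>)\<in>(A \<rightarrow>\<^sub>E S) \<times> (B \<rightarrow>\<^sub>E S). f \<beta> * g \<gamma>)"
  proof (rule sum.reindex_bij_witness
      [where i = "\<lambda>(\<beta>, \<gamma>) x. if x \<in> A then \<beta> x else \<gamma> x"
         and j = "\<lambda>\<alpha>. (restrict \<alpha> A, restrict \<alpha> B)"], goal_cases)
    case (1 \<alpha>)
    then show ?case by (auto simp: fun_eq_iff PiE_def extensional_def)
  next
    case (2 \<alpha>)
    then show ?case by auto
  next
    case (3 b)
    then show ?case
      by (auto simp: fun_eq_iff PiE_def extensional_def disj split: prod.splits)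
  next
    case (4 b)
    then show ?case
      by (auto simp: PiE_def extensional_def split: prod.splits)
  next
    case (5 \<alpha>)
    then show ?case by simp
  qed
  also have "\<dots> = (\<Sum>\<alpha>\<in>A \<rightarrow>\<^sub>E S. f \<alpha>) * (\<Sum>\<alpha>\<in>B \<rightarrow>\<^sub>E S. g \<alpha>)"
    by (simp add: sum_product sum.cartesian_product)
  finally show ?thesis .
qed

text \<open>Weighted counts factor along a partition of the variables.  The predicates \<open>P\<close> and \<open>Q\<close>
  stand for satisfaction of a formula, or for the always true predicate, which no formula
  expresses.\<close>

lemma sum_assignments_factor:
  fixes w :: "'v literal \<Rightarrow> rat"
  assumes "finite A" "finite B" "A \<inter> B = {}"
    and P: "\<And>\<alpha>. P (restrict \<alpha> A) = P \<alpha>" and Q: "\<And>\<alpha>. Q (restrict \<alpha> B) = Q \<alpha>"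
  shows "(\<Sum>\<alpha>\<in>A \<union> B \<rightarrow>\<^sub>E UNIV. of_bool (P \<alpha> \<and> Q \<alpha>) * (\<Prod>x\<in>A \<union> B. w (literal_of \<alpha> x))) =
    (\<Sum>\<alpha>\<in>A \<rightarrow>\<^sub>E UNIV. of_bool (P \<alpha>) * (\<Prod>x\<in>A. w (literal_of \<alpha> x))) *
    (\<Sum>\<alpha>\<in>B \<rightarrow>\<^sub>E UNIV. of_bool (Q \<alpha>) * (\<Prod>x\<in>B. w (literal_of \<alpha> x)))"
proof -
  have restrict: "(\<Prod>x\<in>C. w (literal_of (restrict \<alpha> C) x)) = (\<Prod>x\<in>C. w (literal_of \<alpha> x))" for \<alpha> C
    by (intro prod.cong) (auto simp: literal_of_def)
  show ?thesis
    by (subst sum_PiE_Un [OF assms(3), symmetric])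
      (intro sum.cong refl,
       simp add: restrict P Q prod.union_disjoint [OF assms(1-3)] of_bool_conj algebra_simps)
qed

lemma count_over_Conj:
  assumes "finite X" "vars \<phi> \<union> vars \<psi> \<subseteq> X" "vars \<phi> \<inter> vars \<psi> = {}"
  shows "count_over X w (Conj \<phi> \<psi>) = count_over (vars \<phi>) w \<phi> * count_over (X - vars \<phi>) w \<psi>"
proof -
  have X: "X = vars \<phi> \<union> (X - vars \<phi>)" and "vars \<psi> \<subseteq> X - vars \<phi>"
    using assms by auto
  then have "satisfies (restrict \<alpha> (X - vars \<phi>)) \<psi> = satisfies \<alpha> \<psi>" for \<alpha>
    by (intro satisfies_restrict)
  then show ?thesis
    using sum_assignments_factor [of "vars \<phi>" "X - vars \<phi>" "\<lambda>\<alpha>. satisfies \<alpha> \<phi>" "\<lambda>\<alpha>. satisfies \<alpha> \<psi>" w]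
      assms(1) X by (simp add: count_over_def satisfies_restrict)
qed

lemma count_over_single: "count_over {lit_var l} w (Lit l) = w l"
proof -
  have "({lit_var l} \<rightarrow>\<^sub>E (UNIV :: bool set)) =
    {(\<lambda>x. undefined)(lit_var l := True), (\<lambda>x. undefined)(lit_var l := False)}"
    by (auto simp: PiE_insert_eq [of "lit_var l" "{}"] UNIV_bool image_iff)
  moreover have "(\<lambda>x. undefined :: bool)(lit_var l := True) \<noteq> (\<lambda>x. undefined)(lit_var l := False)"
    by (metis fun_upd_same)
  ultimately show ?thesis
    by (cases l) (simp_all add: count_over_def literal_of_def)
qed

lemma sum_all_assignments:
  assumes "finite X"
  shows "(\<Sum>\<alpha>\<in>X \<rightarrow>\<^sub>E UNIV. \<Prod>x\<in>X. w (literal_of \<alpha> x)) = (\<Prod>x\<in>X. scale w x)"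
proof -
  have "(\<Prod>x\<in>X. scale w x) = (\<Prod>x\<in>X. \<Sum>b\<in>UNIV. w (if b then Pos x else Neg x))"
    by (simp add: scale_def UNIV_bool add.commute)
  then show ?thesis
    by (simp add: prod_sum_PiE assms literal_of_def)
qed

lemma count_over_Lit:
  assumes "finite X" "lit_var l \<in> X"
  shows "count_over X w (Lit l) = w l * (\<Prod>x\<in>X - {lit_var l}. scale w x)"
proof -
  have X: "X = {lit_var l} \<union> (X - {lit_var l})"
    using assms by auto
  have "count_over X w (Lit l) = count_over {lit_var l} w (Lit l) *
    (\<Sum>\<alpha>\<in>X - {lit_var l} \<rightarrow>\<^sub>E UNIV. \<Prod>x\<in>X - {lit_var l}. w (literal_of \<alpha> x))"
    using sum_assignments_factor [of "{lit_var l}" "X - {lit_var l}"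
        "\<lambda>\<alpha>. satisfies \<alpha> (Lit l)" "\<lambda>_. True" w]
      assms satisfies_restrict [of "Lit l" "{lit_var l}"] X
    by (simp add: count_over_def insert_absorb)
  then show ?thesis
    using assms by (simp add: count_over_single sum_all_assignments)
qed

lemma count_over_Disj:
  assumes "\<And>\<alpha>. \<not> (satisfies \<alpha> \<phi> \<and> satisfies \<alpha> \<psi>)"
  shows "count_over X w (Disj \<phi> \<psi>) = count_over X w \<phi> + count_over X w \<psi>"
  unfolding count_over_def sum.distrib [symmetric]
  using assms by (intro sum.cong) auto

text \<open>A variable of \<open>X\<close> that is missing from the formula is free, and contributes its scale
  factor.  In a disjunction the two sides may miss different variables; either of the two
  conditions (smoothness, or scale factors equal to one) makes both contributions equal.\<close>

lemma count_over_eq_exact_eval: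
  assumes "decision_dnnf \<phi>" "finite X" "vars \<phi> \<subseteq> X" "smooth \<phi> \<or> (\<forall>x\<in>X. scale w x = 1)"
  shows "count_over X w \<phi> = exact_eval w \<phi> * (\<Prod>x\<in>X - vars \<phi>. scale w x)"
  using assms
proof (induction \<phi> arbitrary: X rule: decision_dnnf_induct)
  case (Lit l)
  then show ?case by (simp add: count_over_Lit)
next
  case (Conj \<phi> \<psi>)
  have "smooth \<phi> \<or> (\<forall>x\<in>vars \<phi>. scale w x = 1)" "smooth \<psi> \<or> (\<forall>x\<in>X - vars \<phi>. scale w x = 1)"
    using Conj.prems by (auto simp: smooth_def)
  moreover have "vars \<psi> \<subseteq> X - vars \<phi>"
    using Conj by auto
  ultimately show ?case
    using Conj by (simp add: count_over_Conj set_diff_eq conj_ac)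
next
  case (Decide x \<phi> \<psi>)
  let ?X = "X - {x}"
  have sm: "smooth \<phi> \<or> (\<forall>y\<in>?X. scale w y = 1)" "smooth \<psi> \<or> (\<forall>y\<in>?X. scale w y = 1)"
    using Decide.prems by (auto simp: smooth_def)
  have sub: "vars \<phi> \<subseteq> ?X" "vars \<psi> \<subseteq> ?X" "x \<in> X"
    using Decide by auto
  have pos: "count_over X w (Conj (Lit (Pos x)) \<phi>) = w (Pos x) * count_over ?X w \<phi>"
    using count_over_Conj [of X "Lit (Pos x)" \<phi> w] count_over_single [of "Pos x" w] Decide by simp
  have neg: "count_over X w (Conj (Lit (Neg x)) \<psi>) = w (Neg x) * count_over ?X w \<psi>"
    using count_over_Conj [of X "Lit (Neg x)" \<psi> w] count_over_single [of "Neg x" w] Decide by simp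
  have "(\<Prod>y\<in>?X - vars \<phi>. scale w y) = (\<Prod>y\<in>?X - (vars \<phi> \<union> vars \<psi>). scale w y) \<and>
        (\<Prod>y\<in>?X - vars \<psi>. scale w y) = (\<Prod>y\<in>?X - (vars \<phi> \<union> vars \<psi>). scale w y)"
    using Decide.prems(3)
  proof
    assume "smooth (Disj (Conj (Lit (Pos x)) \<phi>) (Conj (Lit (Neg x)) \<psi>))"
    then have "insert x (vars \<phi>) = insert x (vars \<psi>)"
      by (auto simp: smooth_def)
    then have "vars \<phi> = vars \<psi>"
      using Decide.hyps by (simp add: insert_ident)
    then show ?thesis by simp
  next
    assume "\<forall>x\<in>X. scale w x = 1"
    then show ?thesis by simp
  qed
  moreover have "?X - (vars \<phi> \<union> vars \<psi>) =
      X - vars (Disj (Conj (Lit (Pos x)) \<phi>) (Conj (Lit (Neg x)) \<psi>))"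
    by auto
  ultimately show ?case
    using Decide.IH(1) [OF _ sub(1) sm(1)] Decide.IH(2) [OF _ sub(2) sm(2)] \<open>finite X\<close>
    by (subst count_over_Disj) (simp_all add: pos neg algebra_simps)
qed

corollary weighted_count_eq_exact_eval:
  assumes "decision_dnnf \<phi>" "smooth \<phi> \<or> (\<forall>x\<in>vars \<phi>. scale w x = 1)"
  shows "weighted_count w \<phi> = exact_eval w \<phi>"
  using count_over_eq_exact_eval [OF assms(1) _ _ assms(2)]
  by (simp add: weighted_count_eq_count_over)

lemma weighted_count_rescaled:
  assumes "\<forall>x\<in>vars \<phi>. scale w x \<noteq> 0"
  shows "weighted_count w \<phi> = weighted_count (rescaled w) \<phi> * (\<Prod>x\<in>vars \<phi>. scale w x)"
proof -
  have "(\<Prod>x\<in>vars \<phi>. w (literal_of \<alpha> x)) =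
      (\<Prod>x\<in>vars \<phi>. rescaled w (literal_of \<alpha> x)) * (\<Prod>x\<in>vars \<phi>. scale w x)" for \<alpha>
    unfolding prod.distrib [symmetric] using assms
    by (intro prod.cong) (auto simp: rescaled_def literal_of_def)
  then show ?thesis
    by (simp add: weighted_count_eq_count_over count_over_def sum_distrib_right mult.assoc)
qed

section \<open>Accumulation of relative errors\<close>

text \<open>The number \<open>v'\<close> approximates the nonnegative number \<open>v\<close> up to \<open>k\<close> relative errors of size
  at most \<open>e\<close>.  For \<open>v = 0\<close> this forces \<open>v' = 0\<close>.\<close>

definition close_to :: "rat \<Rightarrow> nat \<Rightarrow> rat \<Rightarrow> rat \<Rightarrow> bool" where
  "close_to e k v' v \<longleftrightarrow> 0 \<le> v \<and> (1 - e) ^ k * v \<le> v' \<and> v' \<le> (1 + e) ^ k * v"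

lemma close_to_nonneg:
  assumes "e \<le> 1" "close_to e k v' v"
  shows "0 \<le> v'"
proof -
  have "0 \<le> (1 - e) ^ k * v"
    using assms by (simp add: close_to_def)
  then show ?thesis
    using assms(2) unfolding close_to_def by linarith
qed

lemma close_to_mono:
  assumes "0 \<le> e" "e \<le> 1" "k \<le> m" "close_to e k v' v"
  shows "close_to e m v' v"
proof -
  have "(1 - e) ^ m * v \<le> (1 - e) ^ k * v" "(1 + e) ^ k * v \<le> (1 + e) ^ m * v"
    using assms unfolding close_to_def
    by (intro mult_right_mono power_decreasing power_increasing; simp)+
  then show ?thesis
    using assms(4) unfolding close_to_def by linarith
qed

lemma close_to_mult:
  assumes "0 \<le> e" "e \<le> 1" "close_to e k a' a" "close_to e m b' b"
  shows "close_to e (k + m) (a' * b') (a * b)"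
proof -
  have nonneg: "0 \<le> a" "0 \<le> b" "0 \<le> a'" "0 \<le> b'"
    using assms close_to_nonneg by (auto simp: close_to_def)
  have "((1 - e) ^ k * a) * ((1 - e) ^ m * b) \<le> a' * b'"
    using assms nonneg by (intro mult_mono) (auto simp: close_to_def)
  moreover have "a' * b' \<le> ((1 + e) ^ k * a) * ((1 + e) ^ m * b)"
    using assms nonneg by (intro mult_mono) (auto simp: close_to_def)
  ultimately show ?thesis
    using nonneg by (simp add: close_to_def power_add algebra_simps)
qed

lemma close_to_add:
  assumes "close_to e k a' a" "close_to e k b' b"
  shows "close_to e k (a' + b') (a + b)"
  using assms unfolding close_to_def distrib_left by linarith

lemma close_to_trans:
  assumes "0 \<le> e" "e \<le> 1" "close_to e k v' v" "close_to e m v'' v'"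
  shows "close_to e (k + m) v'' v"
proof -
  have "(1 - e) ^ m * ((1 - e) ^ k * v) \<le> (1 - e) ^ m * v'"
    "(1 + e) ^ m * v' \<le> (1 + e) ^ m * ((1 + e) ^ k * v)"
    using assms by (auto simp: close_to_def intro!: mult_left_mono)
  then have "(1 - e) ^ (k + m) * v \<le> (1 - e) ^ m * v'" "(1 + e) ^ m * v' \<le> (1 + e) ^ (k + m) * v"
    by (simp_all add: power_add algebra_simps)
  then show ?thesis
    using assms(3,4) unfolding close_to_def by linarith
qed

lemma close_to_of_fp_approx:
  assumes "fp_approx p v' v" "0 \<le> v" "0 < p"
  shows "close_to (1 / 2 ^ p) 1 v' v"
proof (cases "v = 0")
  case True
  have "(1 :: rat) / 2 ^ p < 1"
    using assms(3) by simp
  then have "v' = 0"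
    using assms(1) True unfolding fp_approx_def rel_error_def by (simp split: if_splits)
  then show ?thesis
    using True by (simp add: close_to_def)
next
  case False
  then have "\<bar>v' - v\<bar> \<le> 1 / 2 ^ p * v"
    using assms by (simp add: fp_approx_def rel_error_def divide_le_eq)
  then show ?thesis
    using assms(2) unfolding close_to_def power_one_right left_diff_distrib distrib_right by linarith
qed

lemma close_to_Rnd:
  assumes "fp_rounding p Rnd" "0 < p" "close_to (1 / 2 ^ p) k v' v"
  shows "close_to (1 / 2 ^ p) (k + 1) (Rnd v') v"
proof -
  have "0 \<le> v'"
    using assms(3) by (rule close_to_nonneg [rotated]) simp
  then have "close_to (1 / 2 ^ p) 1 (Rnd v') v'"
    using assms by (intro close_to_of_fp_approx) (auto simp: fp_rounding_def)
  then show ?thesis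
    using assms(3) by (intro close_to_trans) auto
qed

lemma close_to_Rnd_mult:
  assumes "fp_rounding p Rnd" "0 < p"
    "close_to (1 / 2 ^ p) k a' a" "close_to (1 / 2 ^ p) m b' b"
  shows "close_to (1 / 2 ^ p) (k + m + 1) (Rnd (a' * b')) (a * b)"
  by (intro close_to_Rnd [OF assms(1,2)] close_to_mult [OF _ _ assms(3,4)]) simp_all

lemma close_to_fp_eval:
  assumes "decision_dnnf \<phi>" and rnd: "fp_rounding p Rnd" "0 < p"
    and "fp_literals p (vars \<phi>) W' W" "\<And>l. lit_var l \<in> vars \<phi> \<Longrightarrow> 0 \<le> W l"
  shows "close_to (1 / 2 ^ p) (3 * card (vars \<phi>) - 2) (fp_eval Rnd W' \<phi>) (exact_eval W \<phi>)"
proof -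
  have "\<forall>l. lit_var l \<in> vars \<phi> \<longrightarrow> close_to (1 / 2 ^ p) 1 (W' l) (W l)"
    using assms(3-5) close_to_of_fp_approx unfolding fp_literals_def by blast
  with assms(1) show ?thesis
  proof (induction \<phi> rule: decision_dnnf_induct)
    case (Lit l)
    then show ?case by simp
  next
    case (Conj \<phi> \<psi>)
    have "close_to (1 / 2 ^ p) ((3 * card (vars \<phi>) - 2) + (3 * card (vars \<psi>) - 2) + 1)
        (fp_eval Rnd W' (Conj \<phi> \<psi>)) (exact_eval W (Conj \<phi> \<psi>))"
      using Conj by (auto intro: close_to_Rnd_mult [OF rnd, simplified])
    moreover have "card (vars (Conj \<phi> \<psi>)) = card (vars \<phi>) + card (vars \<psi>)"
      using Conj by (simp add: card_Un_disjoint)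
    ultimately show ?case
      using card_vars_ge_1 [of \<phi>] card_vars_ge_1 [of \<psi>]
      by (elim close_to_mono [rotated 3]) auto
  next
    case (Decide x \<phi> \<psi>)
    let ?D = "Disj (Conj (Lit (Pos x)) \<phi>) (Conj (Lit (Neg x)) \<psi>)"
    let ?k = "3 * (card (vars ?D) - 1)"
    have vars_D: "vars ?D - {x} = vars \<phi> \<union> vars \<psi>"
      using Decide.hyps by auto
    then have card_D: "card (vars ?D) - 1 = card (vars \<phi> \<union> vars \<psi>)"
      by (metis card_Diff_singleton finite_vars insertI1 vars.simps(1-3) lit_var.simps(1) UnI1)
    then have le: "card (vars \<phi>) \<le> card (vars ?D) - 1" "card (vars \<psi>) \<le> card (vars ?D) - 1"
      by (auto intro: card_mono)
    \<comment> \<open>Rounded addition needs one order for both sides; \<open>?k\<close> bounds it in terms of all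
      variables other than \<open>x\<close>.\<close>
    have branch: "close_to (1 / 2 ^ p) ?k (Rnd (W' l * fp_eval Rnd W' \<chi>)) (W l * exact_eval W \<chi>)"
      if "lit_var l = x" "\<chi> \<in> {\<phi>, \<psi>}" for l \<chi>
    proof -
      have "close_to (1 / 2 ^ p) 1 (W' l) (W l)"
        using Decide.prems that by auto
      moreover have
        "close_to (1 / 2 ^ p) (3 * card (vars \<chi>) - 2) (fp_eval Rnd W' \<chi>) (exact_eval W \<chi>)"
        using Decide that by auto
      ultimately have "close_to (1 / 2 ^ p) (1 + (3 * card (vars \<chi>) - 2) + 1)
          (Rnd (W' l * fp_eval Rnd W' \<chi>)) (W l * exact_eval W \<chi>)"
        by (rule close_to_Rnd_mult [OF rnd])
      then show ?thesis
        using le that card_vars_ge_1 [of \<chi>] by (elim close_to_mono [rotated 3]) auto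
    qed
    have "close_to (1 / 2 ^ p) (?k + 1) (fp_eval Rnd W' ?D) (exact_eval W ?D)"
      using branch [of "Pos x" \<phi>] branch [of "Neg x" \<psi>]
      by (auto intro: close_to_Rnd [OF rnd, simplified] close_to_add)
    moreover have "?k + 1 = 3 * card (vars ?D) - 2"
      using card_vars_ge_1 [of ?D] by linarith
    ultimately show ?case by simp
  qed
qed

lemma fp_prod_finite_nonempty: "fp_prod Rnd s' X P \<Longrightarrow> finite X \<and> X \<noteq> {}"
  by (induction rule: fp_prod.induct) auto

lemma close_to_fp_prod:
  assumes "fp_prod Rnd s' X P" and rnd: "fp_rounding p Rnd" "0 < p"
    and "\<And>x. x \<in> X \<Longrightarrow> close_to (1 / 2 ^ p) 1 (s' x) (s x)"
  shows "close_to (1 / 2 ^ p) (2 * card X - 1) P (\<Prod>x\<in>X. s x)"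
  using assms(1,4)
proof (induction rule: fp_prod.induct)
  case (single x)
  then show ?case by simp
next
  case (mult X P Y Q)
  have fin: "finite X" "X \<noteq> {}" "finite Y" "Y \<noteq> {}"
    using fp_prod_finite_nonempty [OF mult.hyps(1)] fp_prod_finite_nonempty [OF mult.hyps(2)] by auto
  then have "card X \<ge> 1" "card Y \<ge> 1"
    by (simp_all add: Suc_le_eq card_gt_0_iff)
  then have "(2 * card X - 1) + (2 * card Y - 1) + 1 = 2 * card (X \<union> Y) - 1"
    using fin mult.hyps by (simp add: card_Un_disjoint)
  moreover have "(\<Prod>x\<in>X \<union> Y. s x) = (\<Prod>x\<in>X. s x) * (\<Prod>x\<in>Y. s x)"
    using fin mult.hyps by (simp add: prod.union_disjoint)
  ultimately show ?case
    using close_to_Rnd_mult [OF rnd mult.IH(1) mult.IH(2)] mult.prems by (metis UnI1 UnI2)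
qed

section \<open>From accumulated errors to decimal precision\<close>

lemma one_plus_power_le:
  fixes e :: "'a :: linordered_field"
  assumes "0 \<le> e" "of_nat k * e \<le> 1"
  shows "(1 + e) ^ k \<le> 1 + of_nat k * e + (of_nat k * e)\<^sup>2"
  using assms(2)
proof (induction k)
  case 0
  then show ?case by simp
next
  case (Suc k)
  have k: "of_nat k * e \<le> 1"
    using Suc.prems assms(1) by (simp add: algebra_simps)
  have "(1 + e) ^ Suc k \<le> (1 + of_nat k * e + (of_nat k * e)\<^sup>2) * (1 + e)"
    using Suc.IH [OF k] assms(1) by (simp add: mult.commute mult_right_mono)
  also have "\<dots> = 1 + of_nat (Suc k) * e + (of_nat (Suc k) * e)\<^sup>2
      - e\<^sup>2 * (1 + of_nat k * (1 - of_nat k * e))"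
    by (simp add: power2_eq_square algebra_simps)
  also have "\<dots> \<le> 1 + of_nat (Suc k) * e + (of_nat (Suc k) * e)\<^sup>2"
    using k by simp
  finally show ?case .
qed

text \<open>The first order part of the error is \<open>k * e\<close>; the hypothesis \<open>k\<^sup>2 \<le> m * N\<close>, where
  \<open>N * e \<le> 1\<close>, bounds the second order part by \<open>m * e\<close>.\<close>

lemma rel_error_le:
  fixes k m N :: nat
  assumes "close_to e k v' v" "0 \<le> e" "of_nat N * e \<le> 1" "k \<le> N" "k\<^sup>2 \<le> m * N"
  shows "rel_error v' v \<le> of_nat (k + m) * e"
proof (cases "v = 0")
  case True
  then show ?thesis
    using assms by (simp add: close_to_def rel_error_def)
next
  case False
  then have v: "0 < v"
    using assms(1) by (simp add: close_to_def)
  have "of_nat k * e \<le> of_nat N * e"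
    using assms by (intro mult_right_mono) auto
  then have ke: "of_nat k * e \<le> 1"
    using assms by linarith
  have "(of_nat k * e)\<^sup>2 = of_nat (k\<^sup>2) * e * e"
    by (simp add: power2_eq_square)
  also have "\<dots> \<le> of_nat (m * N) * e * e"
    using assms by (intro mult_right_mono of_nat_mono) auto
  also have "\<dots> = (of_nat N * e) * (of_nat m * e)"
    by simp
  also have "\<dots> \<le> 1 * (of_nat m * e)"
    using assms by (intro mult_right_mono) auto
  finally have "(1 + e) ^ k \<le> 1 + of_nat (k + m) * e"
    using one_plus_power_le [OF assms(2) ke] by (simp add: algebra_simps)
  then have up: "v' \<le> (1 + of_nat (k + m) * e) * v"
    using assms(1) v unfolding close_to_def by (meson mult_right_mono order.trans less_imp_le)
  have "1 + of_nat k * (- e) \<le> (1 + (- e)) ^ k"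
  proof (cases "k = 0")
    case False
    then have "1 * e \<le> of_nat k * e"
      using assms(2) by (intro mult_right_mono) auto
    then show ?thesis
      using ke by (intro Bernoulli_inequality) linarith
  qed simp
  moreover have "of_nat k * e \<le> of_nat (k + m) * e"
    using assms(2) by (intro mult_right_mono) auto
  ultimately have "1 - of_nat (k + m) * e \<le> (1 - e) ^ k"
    by simp
  then have "(1 - of_nat (k + m) * e) * v \<le> v'"
    using assms(1) v unfolding close_to_def by (meson mult_right_mono order.trans less_imp_le)
  with up have "\<bar>v' - v\<bar> \<le> of_nat (k + m) * e * v"
    unfolding left_diff_distrib distrib_right by linarith
  then show ?thesis
    using v by (simp add: rel_error_def divide_le_eq)
qed

lemma decimal_precision_ge:
  assumes "rel_error v' v \<le> of_nat (c * n) * (1 / 2 ^ p)" "0 < n" "0 < c"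
  shows "ereal (real p * log 10 2 - log 10 (real n) - log 10 (real c)) \<le> decimal_precision v' v"
proof (cases "rel_error v' v = 0")
  case True
  then show ?thesis by (simp add: decimal_precision_def)
next
  case False
  let ?r = "real_of_rat (rel_error v' v)"
  have "0 < rel_error v' v"
    using False by (auto simp: rel_error_def split: if_splits)
  then have pos: "0 < ?r"
    by simp
  have "?r \<le> real_of_rat (of_nat (c * n) * (1 / 2 ^ p))"
    using assms(1) by (simp only: of_rat_less_eq)
  also have "\<dots> = real c * real n / 2 ^ p"
    by (simp add: of_rat_mult of_rat_divide of_rat_power)
  finally have "log 10 ?r \<le> log 10 (real c * real n / 2 ^ p)"
    using pos by (subst log_le_cancel_iff) (auto simp: assms)
  also have "\<dots> = log 10 (real c) + log 10 (real n) - real p * log 10 2"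
    using assms by (simp add: log_mult log_divide log_nat_power)
  finally have "real p * log 10 2 - log 10 (real n) - log 10 (real c) \<le> - log 10 ?r"
    by linarith
  then show ?thesis
    using False by (simp add: decimal_precision_def max_def)
qed

lemma four_square_le_power:
  assumes "log 2 (real n) \<le> real p / 2 - 1" "0 < n"
  shows "4 * n\<^sup>2 \<le> 2 ^ p"
proof -
  have "log 2 (2 powr 2 :: real) = 2"
    by (rule log_powr_cancel) simp_all
  then have "log 2 (real (4 * n\<^sup>2)) = 2 + 2 * log 2 (real n)"
    using assms(2) by (simp add: log_mult log_nat_power)
  also have "\<dots> \<le> real p"
    using assms(1) by simp
  finally have "real (4 * n\<^sup>2) \<le> 2 powr real p"
    using assms(2) by (subst (asm) log_le_iff) auto
  then have "real (4 * n\<^sup>2) \<le> real (2 ^ p)"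
    by (simp add: powr_realpow)
  then show ?thesis
    by (simp only: of_nat_le_iff)
qed

theorem theorem1:
  fixes \<phi> :: "'v nnf" and w :: "'v literal \<Rightarrow> rat" and Rnd :: "rat \<Rightarrow> rat"
    and n p :: nat and w_hat :: rat
  assumes "decision_dnnf \<phi>"
    and "card (vars \<phi>) = n"
    and "\<forall>x\<in>vars \<phi>. w (Pos x) \<ge> 0 \<and> w (Neg x) \<ge> 0"
    and "fp_rounding p Rnd"
    and "log 2 (real n) \<le> real p / 2 - 1"
  shows "(computed_with_rescaling p Rnd w \<phi> w_hat \<longrightarrow>
            decimal_precision w_hat (weighted_count w \<phi>)
              \<ge> ereal (real p * log 10 2 - log 10 (real n) - log 10 7)) \<and>
         (computed_without_rescaling p Rnd w \<phi> w_hat \<longrightarrow>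
            decimal_precision w_hat (weighted_count w \<phi>)
              \<ge> ereal (real p * log 10 2 - log 10 (real n) - log 10 4))"
proof -
  let ?e = "1 / 2 ^ p :: rat"
  have n: "1 \<le> n"
    using card_vars_ge_1 [of \<phi>] assms(2) by simp
  have N: "4 * n\<^sup>2 \<le> 2 ^ p"
    using assms(5) n by (intro four_square_le_power) auto
  have "0 < p"
  proof (rule ccontr)
    assume "\<not> 0 < p"
    then have "4 * n\<^sup>2 \<le> 1"
      using N by simp
    moreover have "1 \<le> n\<^sup>2"
      using n by simp
    ultimately show False by linarith
  qed
  have "(of_nat (4 * n\<^sup>2) :: rat) \<le> of_nat (2 ^ p)"
    using N by (simp only: of_nat_le_iff)
  then have Ne: "of_nat (4 * n\<^sup>2) * ?e \<le> 1"
    by (simp add: divide_le_eq)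
  have lit_nonneg: "0 \<le> w l" if "lit_var l \<in> vars \<phi>" for l
    using assms(3) that by (cases l) auto
  have scale_nonneg: "0 \<le> scale w x" if "x \<in> vars \<phi>" for x
    using assms(3) that by (simp add: scale_def)
  obtain m where m: "n = Suc m"
    using n by (cases n) auto
  show ?thesis
  proof (intro conjI impI)
    assume "computed_with_rescaling p Rnd w \<phi> w_hat"
    then obtain W' s' P where scale: "\<forall>x\<in>vars \<phi>. scale w x \<noteq> 0"
      and W': "fp_literals p (vars \<phi>) W' (rescaled w)"
      and s': "\<forall>x\<in>vars \<phi>. fp_approx p (s' x) (scale w x)"
      and P: "fp_prod Rnd s' (vars \<phi>) P"
      and w_hat: "w_hat = Rnd (fp_eval Rnd W' \<phi> * P)"
      by (auto simp: computed_with_rescaling_def scale_def)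
    have "close_to ?e (3 * n - 2) (fp_eval Rnd W' \<phi>) (exact_eval (rescaled w) \<phi>)"
      using close_to_fp_eval [OF assms(1,4) \<open>0 < p\<close> W'] lit_nonneg scale_nonneg assms(2)
      by (simp add: rescaled_def)
    moreover have "close_to ?e (2 * n - 1) P (\<Prod>x\<in>vars \<phi>. scale w x)"
      using close_to_fp_prod [OF P assms(4) \<open>0 < p\<close>] s' scale_nonneg \<open>0 < p\<close> assms(2)
      by (metis close_to_of_fp_approx)
    ultimately have "close_to ?e ((3 * n - 2) + (2 * n - 1) + 1) w_hat
        (exact_eval (rescaled w) \<phi> * (\<Prod>x\<in>vars \<phi>. scale w x))"
      unfolding w_hat by (rule close_to_Rnd_mult [OF assms(4) \<open>0 < p\<close>])
    moreover have "(3 * n - 2) + (2 * n - 1) + 1 = 5 * n - 2"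
      using n by simp
    moreover have "\<forall>x\<in>vars \<phi>. scale (rescaled w) x = 1"
      using scale by (auto simp: scale_def rescaled_def simp flip: add_divide_distrib)
    then have "weighted_count w \<phi> = exact_eval (rescaled w) \<phi> * (\<Prod>x\<in>vars \<phi>. scale w x)"
      using weighted_count_rescaled [OF scale] weighted_count_eq_exact_eval [OF assms(1)] by simp
    ultimately have close: "close_to ?e (5 * n - 2) w_hat (weighted_count w \<phi>)"
      by (simp only:)
    \<comment> \<open>The total \<open>7 * n\<close> is the order \<open>5 * n - 2\<close> plus \<open>2 * n + 2\<close> for the second order part.\<close>
    have "5 * n - 2 \<le> 4 * n\<^sup>2" "(5 * n - 2)\<^sup>2 \<le> (2 * n + 2) * (4 * n\<^sup>2)"
      unfolding m by (simp_all add: power2_eq_square algebra_simps)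
    then have "rel_error w_hat (weighted_count w \<phi>) \<le> of_nat ((5 * n - 2) + (2 * n + 2)) * ?e"
      by (intro rel_error_le [OF close _ Ne]) auto
    moreover have "(5 * n - 2) + (2 * n + 2) = 7 * n"
      using n by simp
    ultimately show "decimal_precision w_hat (weighted_count w \<phi>)
        \<ge> ereal (real p * log 10 2 - log 10 (real n) - log 10 7)"
      using decimal_precision_ge [of w_hat "weighted_count w \<phi>" 7 n p] n by simp
  next
    assume "computed_without_rescaling p Rnd w \<phi> w_hat"
    then obtain W' where appl: "smooth \<phi> \<or> (\<forall>x\<in>vars \<phi>. scale w x = 1)"
      and W': "fp_literals p (vars \<phi>) W' w"
      and w_hat: "w_hat = fp_eval Rnd W' \<phi>"
      by (auto simp: computed_without_rescaling_def scale_def)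
    have close: "close_to ?e (3 * n - 2) w_hat (weighted_count w \<phi>)"
      using close_to_fp_eval [OF assms(1,4) \<open>0 < p\<close> W'] lit_nonneg assms(1,2) appl
      by (simp add: w_hat weighted_count_eq_exact_eval)
    \<comment> \<open>The total \<open>4 * n\<close> is the order \<open>3 * n - 2\<close> plus \<open>n + 2\<close> for the second order part.\<close>
    have "3 * n - 2 \<le> 4 * n\<^sup>2" "(3 * n - 2)\<^sup>2 \<le> (n + 2) * (4 * n\<^sup>2)"
      unfolding m by (simp_all add: power2_eq_square algebra_simps)
    then have "rel_error w_hat (weighted_count w \<phi>) \<le> of_nat ((3 * n - 2) + (n + 2)) * ?e"
      by (intro rel_error_le [OF close _ Ne]) auto
    moreover have "(3 * n - 2) + (n + 2) = 4 * n"
      using n by simp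
    ultimately show "decimal_precision w_hat (weighted_count w \<phi>)
        \<ge> ereal (real p * log 10 2 - log 10 (real n) - log 10 4)"
      using decimal_precision_ge [of w_hat "weighted_count w \<phi>" 4 n p] n by simp
  qed
qed

end
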